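(* Let $0\leq r\leq k<n$ be integers. Let $M$ be a positroid of rank $k-r$ on $[n]$ with decorated permutation $\pi^{:}=(\pi,\operatorname{col})$ and CW-arrows $C_1,\dots,C_n$, and let $U_{k,n}$ be the uniform matroid of rank $k$ on $[n]$. Then $M$ is a quotient of $U_{k,n}$ (i.e. $(M,U_{k,n})$ is a flag positroid) if and only if for every $(r+1)$-element subset $S\subseteq[n]$ one has $\left|\bigcup_{i\in S}C_i\right|\geq k+1$.
   Context: $[n]=\{1,\dots,n\}$. For $i\in[n]$ the cyclic order $<_i$ on $[n]$ is $i<_i i+1<_i\cdots<_i n<_i 1<_i\cdots<_i i-1$; for $k$-element sets $A,B$, the Gale order $A\leq_i B$ means that for every $t$, the $t$-th smallest element of $A$ under $<_i$ is $\leq_i$ the $t$-th smallest element of $B$ under $<_i$. A decorated permutation on $[n]$ is a pair $(\pi,\operatorname{col})$ with $\pi$ a permutation of $[n]$ and $\operatorname{col}:[n]\to\{0,1,-1\}$ such that $\operatorname{col}(i)=0$ iff $\pi(i)\neq i$ (fixed points with $\operatorname{col}=1$ are loops, with $\operatorname{col}=-1$ coloops). Its Grassmann necklace is $(I_1,\dots,I_n)$ with $I_i=\{j\in[n]: j<_i\pi^{-1}(j)\text{ or }\operatorname{col}(j)=-1\}$; all $I_i$ have a common size $k$. The positroid of the decorated permutation is the matroid on $[n]$ whose bases are the $k$-subsets $B$ with $I_i\leq_i B$ for all $i$; every positroid arises from a unique decorated permutation. The CW-arrow starting at $i$ is $C_i=[n]$ if $\pi(i)=i$ and $\operatorname{col}(i)=-1$,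 and otherwise $C_i=\{j\in[n]: j\leq_i \pi(i)\}$ (the cyclic interval from $i$ clockwise to $\pi(i)$; for a loop it is $\{i\}$). A matroid $M$ is a quotient of a matroid $N$ on the same ground set if every circuit of $N$ is a union of circuits of $M$; a flag positroid is such a pair with both matroids positroids. *)

theory Defs
  imports "HOL-Combinatorics.Permutations"
begin

section \<open>Matroids\<close>

record 'a set_system =
  ground :: "'a set"
  bases :: "'a set set"

definition matroid :: "'a set_system \<Rightarrow> bool" where
  "matroid M \<longleftrightarrow>
     finite (ground M) \<and> bases M \<noteq> {} \<and> (\<forall>B\<in>bases M. B \<subseteq> ground M) \<and>
     (\<forall>A\<in>bases M. \<forall>B\<in>bases M. \<forall>a\<in>A - B. \<exists>b\<in>B - A. insert b (A - {a}) \<in> bases M)"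

definition indep :: "'a set_system \<Rightarrow> 'a set \<Rightarrow> bool" where
  "indep M X \<longleftrightarrow> (\<exists>B\<in>bases M. X \<subseteq> B)"

definition circuits :: "'a set_system \<Rightarrow> 'a set set" where
  "circuits M = {C. C \<subseteq> ground M \<and> \<not> indep M C \<and> (\<forall>X. X \<subset> C \<longrightarrow> indep M X)}"

text \<open>The common cardinality of the bases; meaningful for matroids only.\<close>

definition matroid_rank :: "'a set_system \<Rightarrow> nat" where
  "matroid_rank M = the_elem (card ` bases M)"

definition matroid_quotient :: "'a set_system \<Rightarrow> 'a set_system \<Rightarrow> bool" where
  "matroid_quotient M N \<longleftrightarrow>
     matroid M \<and> matroid N \<and> ground M = ground N \<and>
     (\<forall>C\<in>circuits N. \<exists>F\<subseteq>circuits M. C = \<Union>F)"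

definition uniform_matroid :: "nat \<Rightarrow> nat \<Rightarrow> nat set_system" where
  "uniform_matroid k n = \<lparr>ground = {1..n}, bases = {B. B \<subseteq> {1..n} \<and> card B = k}\<rparr>"


section \<open>Cyclic orders and the Gale order\<close>

text \<open>
  For \<open>i\<close> and \<open>j\<close> in \<open>{1..n}\<close>, \<open>cyc_pos n i j\<close> is the zero-based position of \<open>j\<close> in the
  enumeration \<open>i, i + 1, \<dots>, n, 1, \<dots>, i - 1\<close>.
\<close>

definition cyc_pos :: "nat \<Rightarrow> nat \<Rightarrow> nat \<Rightarrow> nat" where
  "cyc_pos n i j = (j + n - i) mod n"

definition cyc_less :: "nat \<Rightarrow> nat \<Rightarrow> nat \<Rightarrow> nat \<Rightarrow> bool" where
  "cyc_less n i a b \<longleftrightarrow> cyc_pos n i a < cyc_pos n i b"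

definition cyc_le :: "nat \<Rightarrow> nat \<Rightarrow> nat \<Rightarrow> nat \<Rightarrow> bool" where
  "cyc_le n i a b \<longleftrightarrow> cyc_pos n i a \<le> cyc_pos n i b"

definition cyc_sorted_list :: "nat \<Rightarrow> nat \<Rightarrow> nat set \<Rightarrow> nat list" where
  "cyc_sorted_list n i A = sort_key (cyc_pos n i) (sorted_list_of_set A)"

definition gale_le :: "nat \<Rightarrow> nat \<Rightarrow> nat set \<Rightarrow> nat set \<Rightarrow> bool" where
  "gale_le n i A B \<longleftrightarrow>
     card A = card B \<and>
     (\<forall>t<card A. cyc_le n i (cyc_sorted_list n i A ! t) (cyc_sorted_list n i B ! t))"


section \<open>Decorated permutations and positroids\<close>

definition decorated_permutation :: "nat \<Rightarrow> (nat \<Rightarrow> nat) \<Rightarrow> (nat \<Rightarrow> int) \<Rightarrow> bool" where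
  "decorated_permutation n \<pi> col \<longleftrightarrow>
     \<pi> permutes {1..n} \<and>
     (\<forall>i\<in>{1..n}. col i \<in> {0, 1, -1} \<and> (col i = 0 \<longleftrightarrow> \<pi> i \<noteq> i))"

definition necklace :: "nat \<Rightarrow> (nat \<Rightarrow> nat) \<Rightarrow> (nat \<Rightarrow> int) \<Rightarrow> nat \<Rightarrow> nat set" where
  "necklace n \<pi> col i = {j\<in>{1..n}. cyc_less n i j (inv \<pi> j) \<or> col j = -1}"

text \<open>
  \<open>gale_le\<close> forces every basis to have the common size of the necklace members.
\<close>

definition positroid_of ::
  "nat \<Rightarrow> (nat \<Rightarrow> nat) \<Rightarrow> (nat \<Rightarrow> int) \<Rightarrow> nat set_system \<Rightarrow> bool" where
  "positroid_of n \<pi> col M \<longleftrightarrow>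
     decorated_permutation n \<pi> col \<and> matroid M \<and> ground M = {1..n} \<and>
     bases M = {B. B \<subseteq> {1..n} \<and> (\<forall>i\<in>{1..n}. gale_le n i (necklace n \<pi> col i) B)}"

definition positroid :: "nat \<Rightarrow> nat set_system \<Rightarrow> bool" where
  "positroid n M \<longleftrightarrow> (\<exists>\<pi> col. positroid_of n \<pi> col M)"

definition flag_positroid :: "nat \<Rightarrow> nat set_system \<Rightarrow> nat set_system \<Rightarrow> bool" where
  "flag_positroid n M N \<longleftrightarrow> positroid n M \<and> positroid n N \<and> matroid_quotient M N"

definition CW_arrow :: "nat \<Rightarrow> (nat \<Rightarrow> nat) \<Rightarrow> (nat \<Rightarrow> int) \<Rightarrow> nat \<Rightarrow> nat set" where
  "CW_arrow n \<pi> col i =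
     (if \<pi> i = i \<and> col i = -1 then {1..n} else {j\<in>{1..n}. cyc_le n i j (\<pi> i)})"

end

theory Submission
  imports Defs
begin

text \<open>
  \<open>M\<close> is a quotient of \<open>uniform_matroid k n\<close> iff every \<open>k\<close>-set contains a basis of \<open>M\<close>. Fix a place \<open>c\<close> to
  cut the circle and let \<open>f X\<close> be \<open>card X\<close> minus the number of arrows that lie in \<open>X\<close> and do not
  cross the cut. Then \<open>f\<close> is submodular, it counts the necklace elements on cyclic intervals, and
  it does not grow when the last element of a set is removed.

  If the arrows of an \<open>(r + 1)\<close>-set have a union \<open>U\<close> of size at most \<open>k\<close>, split \<open>U\<close> into cyclic
  intervals: a basis meets \<open>U\<close> in at most \<open>f U \<le> card U - (r + 1)\<close> elements, so it is not contained
  in any \<open>k\<close>-set above \<open>U\<close>. Conversely, the arrow condition says that \<open>f X \<ge> k - r\<close> whenever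
  \<open>card X \<ge> k\<close>, and by submodularity the elements of a \<open>k\<close>-set \<open>H\<close> at which
  \<open>Min {f X | H \<inter> {1..j} \<subseteq> X \<subseteq> {1..j}}\<close> increases with \<open>j\<close> form a basis.
\<close>

section \<open>Matroids\<close>

lemma basis_exchange:
  assumes "matroid M" "A \<in> bases M" "B \<in> bases M" "a \<in> A - B"
  obtains b where "b \<in> B - A" "insert b (A - {a}) \<in> bases M"
  using assms unfolding matroid_def by meson

lemma finite_basis: "matroid M \<Longrightarrow> B \<in> bases M \<Longrightarrow> finite B"
  unfolding matroid_def by (meson finite_subset)

lemma card_exchange:
  assumes "finite A" "a \<in> A" "b \<notin> A"
  shows "card (insert b (A - {a})) = card A"
  using assms card.remove[of A a] by simp

text \<open>Exchanging an element of \<open>A - B\<close> for one of \<open>B - A\<close> keeps the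
  size and brings \<open>A\<close> closer to \<open>B\<close>. Once \<open>A\<close> lies in
  \<open>B\<close>, exchange in the opposite direction forces equality.\<close>

lemma card_bases_eq:
  assumes "matroid M" "A \<in> bases M" "B \<in> bases M"
  shows "card A = card B"
  using assms(2)
proof (induction "card (A - B)" arbitrary: A)
  case 0
  have fin: "finite A" using finite_basis[OF assms(1) 0(2)] .
  have "A \<subseteq> B" using 0 fin by auto
  moreover have "B \<subseteq> A"
  proof (rule ccontr)
    assume "\<not> B \<subseteq> A"
    then obtain b where "b \<in> B - A" by blast
    then obtain a where "a \<in> A - B"
      using basis_exchange[OF assms(1,3) 0(2)] by metis
    then show False using \<open>A \<subseteq> B\<close> by blast
  qed
  ultimately show ?case by simp
next
  case (Suc m)
  have fin: "finite A" using finite_basis[OF assms(1) Suc(3)] .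
  obtain a where a: "a \<in> A - B" using Suc(2) by (metis card.empty equals0I nat.simps(3))
  then obtain b where b: "b \<in> B - A" "insert b (A - {a}) \<in> bases M"
    using basis_exchange[OF assms(1) Suc(3) assms(3)] by metis
  have "insert b (A - {a}) - B = (A - B) - {a}" using a b by blast
  then have "card (insert b (A - {a}) - B) = m" using Suc(2) a fin by simp
  then have "card (insert b (A - {a})) = card B" using Suc(1)[OF _ b(2)] by simp
  moreover have "card (insert b (A - {a})) = card A"
    using a b fin by (intro card_exchange) auto
  ultimately show ?case by simp
qed

lemma card_basis:
  assumes "matroid M" "B \<in> bases M"
  shows "card B = matroid_rank M"
proof -
  have "card ` bases M = {card B}" using card_bases_eq[OF assms(1)] assms(2) by blast
  then show ?thesis by (simp add: matroid_rank_def)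
qed

lemma indep_finite: "matroid M \<Longrightarrow> indep M A \<Longrightarrow> finite A"
  using finite_basis unfolding indep_def by (metis finite_subset)

lemma indep_mono: "indep M B \<Longrightarrow> A \<subseteq> B \<Longrightarrow> indep M A"
  unfolding indep_def by blast

text \<open>Among the bases containing \<open>A\<close>, one with fewest elements outside
  \<open>A \<union> B\<close> works, since an exchange with \<open>B\<close> would remove such an
  element.\<close>

lemma extend_into_basis:
  assumes "matroid M" "indep M A" "B \<in> bases M"
  shows "\<exists>B'\<in>bases M. A \<subseteq> B' \<and> B' \<subseteq> A \<union> B"
proof -
  let ?P = "\<lambda>B'. B' \<in> bases M \<and> A \<subseteq> B'"
  obtain B' where B': "?P B'"
    and least: "\<And>C. ?P C \<Longrightarrow> card (B' - (A \<union> B)) \<le> card (C - (A \<union> B))"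
    using ex_has_least_nat[of ?P _ "\<lambda>C. card (C - (A \<union> B))"] assms(2)
    unfolding indep_def by metis
  have "B' \<subseteq> A \<union> B"
  proof (rule ccontr)
    assume "\<not> B' \<subseteq> A \<union> B"
    then obtain a where a: "a \<in> B' - (A \<union> B)" by blast
    then obtain b where b: "b \<in> B - B'" "insert b (B' - {a}) \<in> bases M"
      using basis_exchange[OF assms(1) _ assms(3), of B' a] B' by blast
    have "insert b (B' - {a}) - (A \<union> B) = (B' - (A \<union> B)) - {a}" using b by blast
    then have "card (insert b (B' - {a}) - (A \<union> B)) < card (B' - (A \<union> B))"
      using a finite_basis[OF assms(1)] B' by (metis card_Diff1_less finite_Diff)
    moreover have "?P (insert b (B' - {a}))" using a b B' by blast
    ultimately show False using least by fastforce
  qed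
  then show ?thesis using B' by blast
qed

text \<open>Otherwise a basis between \<open>A\<close> and \<open>A \<union> B2\<close>, where
  \<open>B2\<close> is a basis containing \<open>B\<close>, avoids \<open>B - A\<close>. It then has
  at most \<open>card A + card (B2 - B)\<close> elements, fewer than \<open>B2\<close>.\<close>

lemma indep_augment:
  assumes "matroid M" "indep M A" "indep M B" "card A < card B"
  shows "\<exists>y\<in>B - A. indep M (insert y A)"
proof (rule ccontr)
  assume no: "\<not> ?thesis"
  obtain B2 where B2: "B2 \<in> bases M" "B \<subseteq> B2" using assms(3) unfolding indep_def by blast
  obtain B1 where B1: "B1 \<in> bases M" "A \<subseteq> B1" "B1 \<subseteq> A \<union> B2"
    using extend_into_basis[OF assms(1,2) B2(1)] by blast
  have "B1 \<subseteq> A \<union> (B2 - B)"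
    using no B1 unfolding indep_def by blast
  then have "card B1 \<le> card A + card (B2 - B)"
    using finite_basis[OF assms(1)] indep_finite[OF assms(1)] assms(2) B2(1)
    by (metis card_Un_le card_mono finite_Diff finite_Un le_trans)
  also have "\<dots> = card A + (card B2 - card B)"
    using B2 finite_basis[OF assms(1)] by (metis card_Diff_subset finite_subset)
  also have "\<dots> < card B2"
    using assms(4) card_mono[OF finite_basis[OF assms(1) B2(1)] B2(2)] by simp
  finally show False using card_bases_eq[OF assms(1) B1(1) B2(1)] by simp
qed

lemma obtain_maximal_indep:
  assumes "matroid M" "finite X" "J0 \<subseteq> X" "indep M J0"
  obtains J where "J0 \<subseteq> J" "J \<subseteq> X" "indep M J" "\<forall>y\<in>X - J. \<not> indep M (insert y J)"
proof -
  define P where "P J \<longleftrightarrow> J0 \<subseteq> J \<and> J \<subseteq> X \<and> indep M J" for J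
  have "\<forall>J. P J \<longrightarrow> card J < Suc (card X)"
    using card_mono[OF assms(2)] by (auto simp: less_Suc_eq_le P_def)
  moreover have "P J0" using assms by (simp add: P_def)
  ultimately obtain J where "P J" and max: "\<forall>K. P K \<longrightarrow> card K \<le> card J"
    using ex_has_greatest_nat[of P J0 card "Suc (card X)"] by blast
  then have J: "J0 \<subseteq> J" "J \<subseteq> X" "indep M J" by (simp_all add: P_def)
  have "\<not> indep M (insert y J)" if y: "y \<in> X - J" for y
  proof
    assume "indep M (insert y J)"
    then have "P (insert y J)" using J y by (auto simp: P_def)
    then have "card (insert y J) \<le> card J" using max by blast
    moreover have "finite J" using J indep_finite[OF assms(1)] by blast
    ultimately show False using y by simp
  qed
  then show thesis using that[of J] J by blast
qed

lemma obtain_circuit: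
  assumes "finite X" "X \<subseteq> ground M" "\<not> indep M X"
  obtains C where "C \<in> circuits M" "C \<subseteq> X"
proof -
  let ?P = "\<lambda>C. C \<subseteq> X \<and> \<not> indep M C"
  obtain C where C: "?P C" "\<And>D. ?P D \<Longrightarrow> card C \<le> card D"
    using ex_has_least_nat[of ?P X card] assms(3) by blast
  have "indep M D" if "D \<subset> C" for D
  proof (rule ccontr)
    assume "\<not> indep M D"
    then have "card C \<le> card D" using C that by blast
    moreover have "card D < card C"
      using that C assms(1) by (meson psubset_card_mono finite_subset)
    ultimately show False by simp
  qed
  then have "C \<in> circuits M" using C assms unfolding circuits_def by blast
  then show ?thesis using that C by blast
qed


section \<open>Quotients of uniform matroids\<close>

lemma ground_uniform [simp]: "ground (uniform_matroid k n) = {1..n}"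
  by (simp add: uniform_matroid_def)

lemma matroid_uniform:
  assumes "k \<le> n"
  shows "matroid (uniform_matroid k n)"
proof -
  have "\<exists>B. B \<subseteq> {1..n} \<and> card B = k" using assms by (metis card_atLeastAtMost diff_Suc_1 obtain_subset_with_card_n)
  moreover have "\<exists>b\<in>B - A. insert b (A - {a}) \<subseteq> {1..n} \<and> card (insert b (A - {a})) = k"
    if "A \<subseteq> {1..n}" "card A = k" "B \<subseteq> {1..n}" "card B = k" "a \<in> A - B" for A B a
  proof -
    have fin: "finite A" "finite B" using that finite_subset by auto
    have "\<not> B \<subseteq> A" using that fin card_subset_eq[OF fin(1)] by blast
    then obtain b where b: "b \<in> B - A" by blast
    have "card (insert b (A - {a})) = k"
      using b that fin card_exchange[of A a b] by auto
    then show ?thesis using b that by blast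
  qed
  ultimately show ?thesis unfolding matroid_def uniform_matroid_def by auto
qed

lemma indep_uniform:
  assumes "k \<le> n"
  shows "indep (uniform_matroid k n) X \<longleftrightarrow> X \<subseteq> {1..n} \<and> card X \<le> k"
proof
  assume "indep (uniform_matroid k n) X"
  then show "X \<subseteq> {1..n} \<and> card X \<le> k"
    unfolding indep_def uniform_matroid_def by (auto intro: card_mono finite_subset)
next
  assume "X \<subseteq> {1..n} \<and> card X \<le> k"
  then show "indep (uniform_matroid k n) X"
    using exists_subset_between[of X k "{1..n}"] assms
    unfolding indep_def uniform_matroid_def by auto
qed

lemma circuits_uniform:
  assumes "k < n"
  shows "circuits (uniform_matroid k n) = {C. C \<subseteq> {1..n} \<and> card C = k + 1}"
proof (intro set_eqI iffI)
  fix C assume "C \<in> circuits (uniform_matroid k n)"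
  then have C: "C \<subseteq> {1..n}" "\<not> card C \<le> k"
    and sub: "\<And>X. X \<subset> C \<Longrightarrow> indep (uniform_matroid k n) X"
    using assms indep_uniform[of k n C] unfolding circuits_def by auto
  have "C \<noteq> {}" using C(2) by auto
  then obtain e where e: "e \<in> C" by blast
  have "indep (uniform_matroid k n) (C - {e})" using sub e by blast
  then have "card (C - {e}) \<le> k" using assms indep_uniform[of k n] by simp
  then show "C \<in> {C. C \<subseteq> {1..n} \<and> card C = k + 1}" using C e by (simp add: card_Diff_singleton)
next
  fix C assume "C \<in> {C. C \<subseteq> {1..n} \<and> card C = k + 1}"
  then have C: "C \<subseteq> {1..n}" "card C = k + 1" by auto
  have "X \<subseteq> {1..n} \<and> card X \<le> k" if "X \<subset> C" for X
    using psubset_card_mono[OF _ that] finite_subset[OF C(1)] C that by auto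
  then show "C \<in> circuits (uniform_matroid k n)"
    using C indep_uniform[of k n] assms unfolding circuits_def by simp
qed

text \<open>A \<open>k\<close>-set \<open>X\<close> that does not span has an element \<open>e\<close> outside its closure, and then \<open>e\<close>
  lies in no circuit inside the uniform circuit \<open>insert e X\<close>.\<close>

lemma quotient_of_uniform_iff:
  assumes M: "matroid M" "ground M = {1..n}" and "k < n"
  shows "matroid_quotient M (uniform_matroid k n) \<longleftrightarrow>
    (\<forall>X. X \<subseteq> {1..n} \<and> card X = k \<longrightarrow> (\<exists>B\<in>bases M. B \<subseteq> X))" (is "?L \<longleftrightarrow> ?R")
proof
  assume L: ?L
  show ?R
  proof (intro allI impI)
    fix X assume X: "X \<subseteq> {1..n} \<and> card X = k"
    then have finX: "finite X" using finite_subset[of X "{1..n}"] by simp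
    show "\<exists>B\<in>bases M. B \<subseteq> X"
    proof (rule ccontr)
      assume no: "\<not> ?thesis"
      have "indep M {}" using M(1) unfolding matroid_def indep_def by auto
      from obtain_maximal_indep[OF M(1) finX empty_subsetI this] obtain J where
        J: "J \<subseteq> X" "indep M J" "\<forall>y\<in>X - J. \<not> indep M (insert y J)" .
      obtain B where B: "B \<in> bases M" "J \<subseteq> B" using J(2) unfolding indep_def by blast
      then obtain e where e: "e \<in> B" "e \<notin> X" using no by blast
      have Je: "indep M (insert e J)" using B e unfolding indep_def by blast
      have "B \<subseteq> {1..n}" using M B(1) unfolding matroid_def by simp
      then have "e \<in> {1..n}" using e by blast
      then have "insert e X \<in> circuits (uniform_matroid k n)"
        using X e finX \<open>k < n\<close> by (simp add: circuits_uniform)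
      then obtain F where F: "F \<subseteq> circuits M" "insert e X = \<Union>F"
        using L unfolding matroid_quotient_def by meson
      then obtain C where C: "C \<in> F" "e \<in> C" by blast
      then have CX: "C - {e} \<subseteq> X" using F by blast
      have "C \<in> circuits M" using C F by blast
      then have Cind: "indep M (C - {e})" "\<not> indep M C"
        using C(2) unfolding circuits_def by auto
      \<comment> \<open>A second maximal independent subset of \<open>X\<close>, chosen to contain
        \<open>C - {e}\<close>. Maximality of \<open>J\<close> makes \<open>J'\<close> no larger
        than \<open>J\<close>, so augmenting \<open>J'\<close> from \<open>insert e J\<close> can
        only add \<open>e\<close>, which would make \<open>C\<close> independent.\<close>
      obtain J' where J': "C - {e} \<subseteq> J'" "J' \<subseteq> X" "indep M J'" "\<forall>y\<in>X - J'. \<not> indep M (insert y J')"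
        using obtain_maximal_indep[OF M(1) finX CX Cind(1)] .
      have "\<not> card J < card J'"
        using indep_augment[OF M(1) J(2) J'(3)] J(3) J'(2) by blast
      moreover have "card (insert e J) = Suc (card J)"
        using e(2) J(1) indep_finite[OF M(1) J(2)] by (intro card_insert_disjoint) auto
      ultimately have "card J' < card (insert e J)" by simp
      then obtain y where "y \<in> insert e J - J'" "indep M (insert y J')"
        using indep_augment[OF M(1) J'(3) Je] by blast
      then have "indep M (insert e J')" using J(1) J'(4) by (cases "y = e") auto
      moreover have "C \<subseteq> insert e J'" using J'(1) by blast
      ultimately show False using Cind(2) indep_mono by metis
    qed
  qed
next
  assume R: ?R
  have "\<exists>F\<subseteq>circuits M. C = \<Union>F" if "C \<in> circuits (uniform_matroid k n)" for C
  proof -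
    have C: "C \<subseteq> {1..n}" "card C = k + 1" using that circuits_uniform[OF \<open>k < n\<close>] by simp_all
    \<comment> \<open>The witness is the fundamental circuit of \<open>e\<close> with respect to a
      basis inside \<open>C - {e}\<close>.\<close>
    have "\<exists>D\<in>circuits M. D \<subseteq> C \<and> e \<in> D" if e: "e \<in> C" for e
    proof -
      have "card (C - {e}) = k" using C e by (simp add: card_Diff_singleton)
      then obtain B where B: "B \<in> bases M" "B \<subseteq> C - {e}"
        using R C(1) subset_trans[OF Diff_subset C(1)] by metis
      have finB: "finite B" using finite_basis[OF M(1) B(1)] .
      have "\<not> indep M (insert e B)"
      proof
        assume "indep M (insert e B)"
        then obtain A where A: "A \<in> bases M" "insert e B \<subseteq> A" unfolding indep_def by blast
        then have "card (insert e B) \<le> card B"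
          using card_mono[OF finite_basis[OF M(1) A(1)] A(2)] card_bases_eq[OF M(1) A(1) B(1)] by simp
        moreover have "e \<notin> B" using B(2) by blast
        ultimately show False using finB by simp
      qed
      moreover have "insert e B \<subseteq> ground M" using M(2) B(2) C(1) e by blast
      ultimately obtain D where D: "D \<in> circuits M" "D \<subseteq> insert e B"
        using obtain_circuit[of "insert e B" M] finB by auto
      have "\<not> D \<subseteq> B" using D(1) B(1) unfolding circuits_def indep_def by blast
      then have "e \<in> D" using D(2) by blast
      moreover have "D \<subseteq> C" using D(2) B(2) e by blast
      ultimately show ?thesis using D(1) by blast
    qed
    then have "C = \<Union>{D \<in> circuits M. D \<subseteq> C}" by blast
    then show ?thesis by (intro exI[of _ "{D \<in> circuits M. D \<subseteq> C}"]) simp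
  qed
  then show ?L
    using M matroid_uniform[of k n] \<open>k < n\<close> unfolding matroid_quotient_def by simp
qed


section \<open>The Gale order by counting\<close>

text \<open>In a strictly increasing list the entries below \<open>x\<close> occupy an initial
  segment of the indices, so comparing the entry at \<open>t\<close> with \<open>x\<close> means
  comparing \<open>t\<close> with their number.\<close>

lemma sorted_list_of_set_nth_less_iff:
  fixes P :: "nat set"
  assumes "finite P" "t < card P"
  shows "sorted_list_of_set P ! t < x \<longleftrightarrow> t < card {p\<in>P. p < x}"
proof -
  let ?l = "sorted_list_of_set P"
  have sl: "sorted_wrt (<) ?l" "length ?l = card P" "set ?l = P" using assms(1) by auto
  have mono: "?l ! s < ?l ! t \<longleftrightarrow> s < t" if "s < card P" "t < card P" for s t
    using sorted_wrt_nth_less[OF sl(1), of s t] sorted_wrt_nth_less[OF sl(1), of t s] that sl(2)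
    by (cases s t rule: linorder_cases) auto
  have bij: "bij_betw ((!) ?l) {..<card P} P"
    using bij_betw_nth[of ?l "{..<card P}" P] sl by simp
  have "(!) ?l ` {s. s < card P \<and> ?l ! s < x} = {p\<in>P. p < x}"
    using bij_betw_imp_surj_on[OF bij] by auto
  then have "bij_betw ((!) ?l) {s. s < card P \<and> ?l ! s < x} {p\<in>P. p < x}"
    by (intro bij_betw_subset[OF bij]) auto
  then have c: "card {s. s < card P \<and> ?l ! s < x} = card {p\<in>P. p < x}"
    by (rule bij_betw_same_card)
  show ?thesis
  proof
    assume "?l ! t < x"
    then have "{..t} \<subseteq> {s. s < card P \<and> ?l ! s < x}"
    proof (intro subsetI CollectI conjI)
      fix s assume "s \<in> {..t}"
      then show "s < card P" using assms(2) by simp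
      then show "?l ! s < x"
        using mono[OF _ assms(2), of s] \<open>?l ! t < x\<close> \<open>s \<in> {..t}\<close> by (cases "s = t") auto
    qed
    then have "card {..t} \<le> card {s. s < card P \<and> ?l ! s < x}" by (intro card_mono) auto
    then show "t < card {p\<in>P. p < x}" using c by simp
  next
    assume t: "t < card {p\<in>P. p < x}"
    show "?l ! t < x"
    proof (rule ccontr)
      assume nt: "\<not> ?l ! t < x"
      have "{s. s < card P \<and> ?l ! s < x} \<subseteq> {..<t}"
      proof
        fix s assume "s \<in> {s. s < card P \<and> ?l ! s < x}"
        then have s: "s < card P" "?l ! s < ?l ! t" using nt by auto
        then show "s \<in> {..<t}" using mono[OF s(1) assms(2)] by simp
      qed
      then have "card {s. s < card P \<and> ?l ! s < x} \<le> t" using card_mono[of "{..<t}"] by auto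
      then show False using t c by simp
    qed
  qed
qed

lemma sorted_list_of_set_le_iff:
  fixes P Q :: "nat set"
  assumes "finite P" "finite Q" "card P = card Q"
  shows "(\<forall>t<card P. sorted_list_of_set P ! t \<le> sorted_list_of_set Q ! t) \<longleftrightarrow>
    (\<forall>x. card {q\<in>Q. q < x} \<le> card {p\<in>P. p < x})" (is "?L \<longleftrightarrow> ?R")
proof
  assume L: ?L
  show ?R
  proof
    fix x
    show "card {q\<in>Q. q < x} \<le> card {p\<in>P. p < x}"
    proof (cases "card {q\<in>Q. q < x}")
      case 0
      then show ?thesis by linarith
    next
      case (Suc t)
      have "card {q\<in>Q. q < x} \<le> card Q" using assms(2) by (intro card_mono) auto
      then have t: "t < card Q" using Suc by simp
      have "sorted_list_of_set Q ! t < x"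
        using sorted_list_of_set_nth_less_iff[OF assms(2) t] Suc by simp
      then have "sorted_list_of_set P ! t < x" using L t assms(3) by (metis le_less_trans)
      then show ?thesis using sorted_list_of_set_nth_less_iff[OF assms(1)] t Suc assms(3) by auto
    qed
  qed
next
  assume R: ?R
  show ?L
  proof (intro allI impI)
    fix t assume t: "t < card P"
    \<comment> \<open>The threshold is the successor of an entry of \<open>Q\<close>: lying strictly
      below it means being at most that entry, so the entry at \<open>t\<close> is itself
      counted.\<close>
    have "t < card {q\<in>Q. q < Suc (sorted_list_of_set Q ! t)}"
      using sorted_list_of_set_nth_less_iff[OF assms(2)] t assms(3) by (metis lessI)
    then have "t < card {p\<in>P. p < Suc (sorted_list_of_set Q ! t)}" using R by (meson less_le_trans)
    then show "sorted_list_of_set P ! t \<le> sorted_list_of_set Q ! t"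
      using sorted_list_of_set_nth_less_iff[OF assms(1) t] by (meson less_Suc_eq_le)
  qed
qed

section \<open>Positions in the cyclic orders and the Gale order\<close>

lemma cyc_pos_eq:
  assumes "c \<in> {1..n}" "j \<in> {1..n}"
  shows "cyc_pos n c j = (if c \<le> j then j - c else j + n - c)"
proof (cases "c \<le> j")
  case True
  then have "j + n - c = (j - c) + n" by simp
  then have "cyc_pos n c j = (j - c) mod n" by (simp only: cyc_pos_def mod_add_self2)
  then show ?thesis using True assms by simp
next
  case False
  then show ?thesis using assms by (simp add: cyc_pos_def)
qed

lemma cyc_pos_less: "c \<in> {1..n} \<Longrightarrow> cyc_pos n c j < n"
  by (simp add: cyc_pos_def)

lemma cyc_pos_self [simp]: "cyc_pos n c c = 0"
  by (simp add: cyc_pos_def)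

lemma inj_on_cyc_pos: "c \<in> {1..n} \<Longrightarrow> inj_on (cyc_pos n c) {1..n}"
  by (rule inj_onI) (auto simp: cyc_pos_eq split: if_splits)

lemma cyc_pos_image:
  assumes "c \<in> {1..n}"
  shows "cyc_pos n c ` {1..n} = {..<n}"
proof (rule card_subset_eq)
  show "card (cyc_pos n c ` {1..n}) = card {..<n}"
    using card_image[OF inj_on_cyc_pos[OF assms]] by simp
qed (use cyc_pos_less[OF assms] in auto)

text \<open>For \<open>c\<close> in \<open>{1..n}\<close> this is the cyclic interval of length
  \<open>min x n\<close> that begins at \<open>c\<close>.\<close>

definition cyc_initial :: "nat \<Rightarrow> nat \<Rightarrow> nat \<Rightarrow> nat set" where
  "cyc_initial n c x = {j\<in>{1..n}. cyc_pos n c j < x}"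

text \<open>On \<open>{1..n}\<close> the map \<open>cyc_pos n c\<close> embeds the cyclic order into
  the natural numbers, where the counting criterion for sorted lists applies. Bounds on cyclic
  intervals are the form in which bases are compared with \<open>rank_bound\<close>.\<close>

lemma gale_le_iff:
  assumes c: "c \<in> {1..n}" and A: "A \<subseteq> {1..n}" and B: "B \<subseteq> {1..n}"
  shows "gale_le n c A B \<longleftrightarrow> card A = card B \<and>
    (\<forall>x. card (B \<inter> cyc_initial n c x) \<le> card (A \<inter> cyc_initial n c x))"
proof -
  let ?p = "cyc_pos n c"
  have map: "map ?p (cyc_sorted_list n c X) = sorted_list_of_set (?p ` X)"
    and len: "length (cyc_sorted_list n c X) = card X"
    and card: "card (?p ` X) = card X"
    and count: "card {q \<in> ?p ` X. q < x} = card (X \<inter> cyc_initial n c x)"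
    if X: "X \<subseteq> {1..n}" for X x
  proof -
    have fin: "finite X" using X finite_subset by blast
    have inj: "inj_on ?p X" using inj_on_cyc_pos[OF c] X inj_on_subset by blast
    show "map ?p (cyc_sorted_list n c X) = sorted_list_of_set (?p ` X)"
      using fin inj
      by (intro sorted_distinct_set_unique) (simp_all add: cyc_sorted_list_def distinct_map)
    show "length (cyc_sorted_list n c X) = card X" by (simp add: cyc_sorted_list_def)
    show "card (?p ` X) = card X" using card_image[OF inj] .
    have "{q \<in> ?p ` X. q < x} = ?p ` (X \<inter> cyc_initial n c x)"
      using X by (auto simp: cyc_initial_def)
    then show "card {q \<in> ?p ` X. q < x} = card (X \<inter> cyc_initial n c x)"
      using card_image[OF inj_on_subset[OF inj]] by (metis inf_le1)
  qed
  have fin: "finite (?p ` A)" "finite (?p ` B)" using A B finite_subset by blast+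
  have nth: "?p (cyc_sorted_list n c X ! t) = sorted_list_of_set (?p ` X) ! t"
    if "X \<subseteq> {1..n}" "t < card X" for X t
    using map[OF that(1)] len[OF that(1)] that(2) nth_map by metis
  show ?thesis
  proof (cases "card A = card B")
    case True
    have "gale_le n c A B \<longleftrightarrow>
        (\<forall>t<card A. sorted_list_of_set (?p ` A) ! t \<le> sorted_list_of_set (?p ` B) ! t)"
      using True nth[OF A] nth[OF B] by (simp add: gale_le_def cyc_le_def)
    then show ?thesis
      using sorted_list_of_set_le_iff[OF fin] card[OF A] card[OF B] count[OF A] count[OF B] True by simp
  qed (simp add: gale_le_def)
qed


text \<open>Changing the start from \<open>c\<close> to \<open>a\<close> rotates the positions, so
  every cyclic order can be read in the coordinates of one cut.\<close>

lemma cyc_pos_shift: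
  assumes "a \<in> {1..n}" "c \<in> {1..n}" "j \<in> {1..n}"
  shows "cyc_pos n a j = (if cyc_pos n c a \<le> cyc_pos n c j then cyc_pos n c j - cyc_pos n c a
    else cyc_pos n c j + n - cyc_pos n c a)"
  using assms by (auto simp: cyc_pos_eq)

lemma cyc_pos_inj:
  assumes "c \<in> {1..n}" "i \<in> {1..n}" "j \<in> {1..n}"
  shows "cyc_pos n c i = cyc_pos n c j \<longleftrightarrow> i = j"
  using inj_on_eq_iff[OF inj_on_cyc_pos[OF assms(1)] assms(2,3)] .

lemma card_cyc_initial:
  assumes "c \<in> {1..n}" "x \<le> n"
  shows "card (cyc_initial n c x) = x"
proof -
  have "cyc_pos n c ` cyc_initial n c x = {p \<in> cyc_pos n c ` {1..n}. p < x}"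
    by (auto simp: cyc_initial_def)
  also have "\<dots> = {..<x}" unfolding cyc_pos_image[OF assms(1)] using assms(2) by auto
  finally have "card (cyc_pos n c ` cyc_initial n c x) = x" by simp
  moreover have "inj_on (cyc_pos n c) (cyc_initial n c x)"
    using inj_on_cyc_pos[OF assms(1)] by (rule inj_on_subset) (auto simp: cyc_initial_def)
  ultimately show ?thesis by (simp add: card_image)
qed

lemma cyc_initial_full: "c \<in> {1..n} \<Longrightarrow> n \<le> x \<Longrightarrow> cyc_initial n c x = {1..n}"
  using cyc_pos_less[of c n] by (auto simp: cyc_initial_def intro: less_le_trans)

lemma cyc_initial_subset: "cyc_initial n c x \<subseteq> {1..n}"
  by (auto simp: cyc_initial_def)

lemma ex_last:
  assumes "finite X" "X \<noteq> {}"
  obtains m :: nat where "m \<in> X" "\<And>j. j \<in> X \<Longrightarrow> cyc_pos n c j \<le> cyc_pos n c m"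
proof -
  have "Max (cyc_pos n c ` X) \<in> cyc_pos n c ` X" using assms by (intro Max_in) auto
  then obtain m where m: "m \<in> X" "Max (cyc_pos n c ` X) = cyc_pos n c m" by blast
  have "cyc_pos n c j \<le> cyc_pos n c m" if "j \<in> X" for j
    using Max_ge[of "cyc_pos n c ` X" "cyc_pos n c j"] assms(1) that m(2) by simp
  then show thesis using that m(1) by blast
qed

lemma ex_first:
  assumes "finite X" "X \<noteq> {}"
  obtains m :: nat where "m \<in> X" "\<And>j. j \<in> X \<Longrightarrow> cyc_pos n c m \<le> cyc_pos n c j"
proof -
  have "Min (cyc_pos n c ` X) \<in> cyc_pos n c ` X" using assms by (intro Min_in) auto
  then obtain m where m: "m \<in> X" "Min (cyc_pos n c ` X) = cyc_pos n c m" by blast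
  have "cyc_pos n c m \<le> cyc_pos n c j" if "j \<in> X" for j
    using Min_le[of "cyc_pos n c ` X" "cyc_pos n c j"] assms(1) that m(2) by simp
  then show thesis using that m(1) by blast
qed


section \<open>Rank bounds from arrows\<close>

locale decorated_perm =
  fixes n :: nat and \<pi> :: "nat \<Rightarrow> nat" and col :: "nat \<Rightarrow> int"
  assumes decorated: "decorated_permutation n \<pi> col"
begin

abbreviation arrow :: "nat \<Rightarrow> nat set" where
  "arrow \<equiv> CW_arrow n \<pi> col"

text \<open>The non-coloops whose arrow does not pass from the predecessor of \<open>c\<close> to \<open>c\<close>.\<close>

definition uncut :: "nat \<Rightarrow> nat set" where
  "uncut c = {b\<in>{1..n}. cyc_le n c b (\<pi> b) \<and> col b \<noteq> -1}"

definition arrows_in :: "nat \<Rightarrow> nat set \<Rightarrow> nat set" where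
  "arrows_in c X = {b\<in>uncut c. arrow b \<subseteq> X}"

text \<open>This is the function \<open>f\<close>, with the circle cut just before \<open>c\<close>.
  Integer values keep the subtraction from being truncated.\<close>

definition rank_bound :: "nat \<Rightarrow> nat set \<Rightarrow> int" where
  "rank_bound c X = int (card X) - int (card (arrows_in c X))"

section \<open>Arrows and cuts of the circle\<close>

lemma permutes: "\<pi> permutes {1..n}"
  using decorated by (simp add: decorated_permutation_def)

lemma perm_in: "b \<in> {1..n} \<Longrightarrow> \<pi> b \<in> {1..n}"
  using permutes_in_image[OF permutes] by blast

lemma perm_eq_iff: "\<pi> a = \<pi> b \<longleftrightarrow> a = b"
  using permutes_inj[OF permutes] by (auto dest: injD)

lemma coloop_fixed:
  assumes "b \<in> {1..n}" "col b = -1"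
  shows "\<pi> b = b"
proof -
  have "col b = 0 \<longleftrightarrow> \<pi> b \<noteq> b" using decorated assms(1) unfolding decorated_permutation_def by blast
  then show ?thesis using assms(2) by simp
qed

lemma coloop_perm_iff: "b \<in> {1..n} \<Longrightarrow> col (\<pi> b) = -1 \<longleftrightarrow> col b = -1"
  using coloop_fixed[of b] coloop_fixed[of "\<pi> b"] perm_in[of b] perm_eq_iff by metis

lemma finite_arrows_in: "finite (arrows_in c X)"
  by (simp add: arrows_in_def uncut_def)

lemma arrow_subset: "arrow b \<subseteq> {1..n}"
  by (auto simp: CW_arrow_def)

lemma arrow_source: "b \<in> {1..n} \<Longrightarrow> b \<in> arrow b"
  by (simp add: CW_arrow_def cyc_le_def)

lemma arrow_target: "b \<in> {1..n} \<Longrightarrow> \<pi> b \<in> arrow b"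
  using perm_in by (simp add: CW_arrow_def cyc_le_def)

text \<open>Once the circle is cut, an arrow that does not cross the cut is an ordinary interval of
  positions.\<close>

lemma arrow_uncut:
  assumes c: "c \<in> {1..n}" and b: "b \<in> uncut c"
  shows "arrow b = {j\<in>{1..n}. cyc_pos n c b \<le> cyc_pos n c j \<and> cyc_pos n c j \<le> cyc_pos n c (\<pi> b)}"
proof -
  have b': "b \<in> {1..n}" "cyc_pos n c b \<le> cyc_pos n c (\<pi> b)" "col b \<noteq> -1"
    using b by (auto simp: uncut_def cyc_le_def)
  have "cyc_le n b j (\<pi> b) \<longleftrightarrow> cyc_pos n c b \<le> cyc_pos n c j \<and> cyc_pos n c j \<le> cyc_pos n c (\<pi> b)"
    if j: "j \<in> {1..n}" for j
    unfolding cyc_le_def cyc_pos_shift[OF b'(1) c j] cyc_pos_shift[OF b'(1) c perm_in[OF b'(1)]]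
    using b'(2) cyc_pos_less[OF c, of j] cyc_pos_less[OF c, of b] cyc_pos_less[OF c, of "\<pi> b"] by auto
  then show ?thesis using b'(3) by (auto simp: CW_arrow_def)
qed

text \<open>An arrow passing from the predecessor of \<open>c\<close> to \<open>c\<close> contains
  \<open>c\<close>, and so does the arrow of a coloop, which is the whole ground set.\<close>

lemma uncut_if_start_notin:
  assumes c: "c \<in> {1..n}" and b: "b \<in> {1..n}" and "c \<notin> arrow b"
  shows "b \<in> uncut c"
proof -
  have col: "col b \<noteq> -1" and lt: "cyc_pos n b (\<pi> b) < cyc_pos n b c"
    using assms coloop_fixed[OF b] by (auto simp: CW_arrow_def cyc_le_def split: if_splits)
  have "cyc_pos n c b \<le> cyc_pos n c (\<pi> b)"
    using lt unfolding cyc_pos_shift[OF b c c] cyc_pos_shift[OF b c perm_in[OF b]]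
    using cyc_pos_less[OF c, of b] cyc_pos_less[OF c, of "\<pi> b"] by (auto split: if_splits)
  then show ?thesis using b col by (simp add: uncut_def cyc_le_def)
qed

text \<open>An arrow across the cut before \<open>1\<close> contains both \<open>n\<close> and
  \<open>1\<close>. Testing at \<open>n\<close> serves sets that may contain \<open>1\<close> but
  omit \<open>n\<close>.\<close>

lemma uncut_if_end_notin:
  assumes b: "b \<in> {1..n}" and "n \<notin> arrow b"
  shows "b \<in> uncut 1"
proof -
  have n: "n \<in> {1..n}" using b by auto
  have col: "col b \<noteq> -1" and lt: "cyc_pos n b (\<pi> b) < cyc_pos n b n"
    using assms n coloop_fixed[OF b] by (auto simp: CW_arrow_def cyc_le_def split: if_splits)
  have "b \<le> \<pi> b" using lt b perm_in[OF b] n by (auto simp: cyc_pos_eq split: if_splits)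
  then show ?thesis using b col perm_in[OF b] by (simp add: uncut_def cyc_le_def cyc_pos_eq)
qed

section \<open>The rank bound: change of cut, submodularity and deletion\<close>

lemma rank_bound_mono_start:
  assumes "\<And>b. b \<in> uncut c \<Longrightarrow> arrow b \<subseteq> X \<Longrightarrow> b \<in> uncut d"
  shows "rank_bound d X \<le> rank_bound c X"
proof -
  have "arrows_in c X \<subseteq> arrows_in d X" using assms by (auto simp: arrows_in_def)
  then show ?thesis using card_mono[OF finite_arrows_in] by (simp add: rank_bound_def)
qed

lemma rank_bound_empty [simp]: "rank_bound c {} = 0"
proof -
  have "arrows_in c {} = {}" using arrow_source by (auto simp: arrows_in_def uncut_def)
  then show ?thesis by (simp add: rank_bound_def)
qed

text \<open>The arrow count is supermodular: an arrow lies in both sets iff it lies in their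
  intersection, while the union may contain arrows that lie in neither.\<close>

lemma rank_bound_submodular:
  assumes "finite X" "finite Y"
  shows "rank_bound c (X \<union> Y) + rank_bound c (X \<inter> Y) \<le> rank_bound c X + rank_bound c Y"
proof -
  have "card (arrows_in c X) + card (arrows_in c Y)
      = card (arrows_in c X \<union> arrows_in c Y) + card (arrows_in c X \<inter> arrows_in c Y)"
    by (rule card_Un_Int[OF finite_arrows_in finite_arrows_in])
  also have "card (arrows_in c X \<union> arrows_in c Y) \<le> card (arrows_in c (X \<union> Y))"
    by (intro card_mono finite_arrows_in) (auto simp: arrows_in_def)
  also have "arrows_in c X \<inter> arrows_in c Y = arrows_in c (X \<inter> Y)"
    by (auto simp: arrows_in_def)
  finally show ?thesis using card_Un_Int[OF assms] by (simp add: rank_bound_def)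
qed

text \<open>\<open>\<pi>\<close> maps the sources of the uncut arrows inside the interval
  bijectively onto its elements outside the necklace member, because an uncut arrow that ends in an
  initial interval lies in it.\<close>

lemma rank_bound_cyc_initial:
  assumes c: "c \<in> {1..n}"
  shows "rank_bound c (cyc_initial n c x) = int (card (necklace n \<pi> col c \<inter> cyc_initial n c x))"
proof -
  let ?W = "cyc_initial n c x" and ?I = "necklace n \<pi> col c"
  have fin: "finite ?W" using finite_subset[OF cyc_initial_subset] by simp
  have I: "\<pi> b \<in> ?I \<longleftrightarrow> b \<notin> uncut c" if b: "b \<in> {1..n}" for b
    using b perm_in[OF b] coloop_perm_iff[OF b] permutes_inverses(2)[OF permutes, of b]
    by (auto simp: necklace_def uncut_def cyc_less_def cyc_le_def)
  have "?W - ?I = \<pi> ` arrows_in c ?W"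
  proof (intro equalityI subsetI)
    fix j assume j: "j \<in> ?W - ?I"
    then have j': "j \<in> {1..n}" "cyc_pos n c j < x" by (auto simp: cyc_initial_def)
    obtain b where b: "b \<in> {1..n}" "j = \<pi> b" using permutes_image[OF permutes] j'(1) by blast
    then have u: "b \<in> uncut c" using I j by blast
    have "arrow b \<subseteq> ?W" using arrow_uncut[OF c u] j'(2) b(2) by (auto simp: cyc_initial_def)
    then show "j \<in> \<pi> ` arrows_in c ?W" using u b(2) by (auto simp: arrows_in_def)
  next
    fix j assume "j \<in> \<pi> ` arrows_in c ?W"
    then obtain b where b: "b \<in> uncut c" "arrow b \<subseteq> ?W" "j = \<pi> b" by (auto simp: arrows_in_def)
    then have "b \<in> {1..n}" by (simp add: uncut_def)
    then show "j \<in> ?W - ?I" using I arrow_target b by blast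
  qed
  moreover have "inj_on \<pi> (arrows_in c ?W)" by (rule inj_onI) (simp add: perm_eq_iff)
  ultimately have "card (?W - ?I) = card (arrows_in c ?W)" by (simp add: card_image)
  moreover have "card ?W = card (?I \<inter> ?W) + card (?W - ?I)"
    using card_Int_Diff[OF fin, of ?I] by (simp add: Int_commute)
  ultimately show ?thesis by (simp add: rank_bound_def)
qed

text \<open>An uncut arrow inside \<open>X\<close> that contains the last element \<open>m\<close>
  must end there, so its source is \<open>inv \<pi> m\<close>. Hence at most one arrow is lost along
  with the one element.\<close>

lemma rank_bound_remove_last:
  assumes c: "c \<in> {1..n}" and X: "X \<subseteq> {1..n}" and m: "m \<in> X"
    and last: "\<And>j. j \<in> X \<Longrightarrow> cyc_pos n c j \<le> cyc_pos n c m"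
  shows "rank_bound c (X - {m}) \<le> rank_bound c X"
proof -
  have fin: "finite X" using X finite_subset[of X "{1..n}"] by simp
  have "arrows_in c X \<subseteq> insert (inv \<pi> m) (arrows_in c (X - {m}))"
  proof
    fix b assume b: "b \<in> arrows_in c X"
    then have u: "b \<in> uncut c" "arrow b \<subseteq> X" "b \<in> {1..n}" by (auto simp: arrows_in_def uncut_def)
    show "b \<in> insert (inv \<pi> m) (arrows_in c (X - {m}))"
    proof (cases "m \<in> arrow b")
      case True
      have "\<pi> b \<in> X" using arrow_target u by blast
      have "cyc_pos n c m \<le> cyc_pos n c (\<pi> b)"
        using True unfolding arrow_uncut[OF c u(1)] by blast
      then have "cyc_pos n c (\<pi> b) = cyc_pos n c m"
        using last[OF \<open>\<pi> b \<in> X\<close>] by simp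
      then have "\<pi> b = m" using cyc_pos_inj[OF c] \<open>\<pi> b \<in> X\<close> X m by blast
      then show ?thesis using permutes_inverses(2)[OF permutes, of b] by simp
    next
      case False
      then show ?thesis using u by (auto simp: arrows_in_def)
    qed
  qed
  then have "card (arrows_in c X) \<le> card (insert (inv \<pi> m) (arrows_in c (X - {m})))"
    by (intro card_mono) (simp_all add: finite_arrows_in)
  also have "\<dots> \<le> Suc (card (arrows_in c (X - {m})))"
    by (simp add: card_insert_if finite_arrows_in)
  finally show ?thesis using card.remove[OF fin m] by (simp add: rank_bound_def)
qed

text \<open>Last elements are deleted until \<open>k\<close> are left; the arrow condition is then
  applied to a set of exactly this size.\<close>

lemma rank_bound_shrink:
  assumes c: "c \<in> {1..n}" and "X \<subseteq> {1..n}" and "k \<le> card X"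
  shows "\<exists>Y\<subseteq>X. card Y = k \<and> rank_bound c Y \<le> rank_bound c X"
  using assms(2,3)
proof (induction "card X - k" arbitrary: X)
  case 0
  then show ?case by (intro exI[of _ X]) simp
next
  case (Suc d)
  have fin: "finite X" using Suc(3) finite_subset[of X "{1..n}"] by simp
  have "X \<noteq> {}" using Suc(2) by auto
  then obtain m where m: "m \<in> X" "\<And>j. j \<in> X \<Longrightarrow> cyc_pos n c j \<le> cyc_pos n c m"
    using ex_last[OF fin] by metis
  have "card (X - {m}) = card X - 1" using m(1) fin by simp
  then have "\<exists>Y\<subseteq>X - {m}. card Y = k \<and> rank_bound c Y \<le> rank_bound c (X - {m})"
    using Suc(2-4) by (intro Suc(1)) auto
  then obtain Y where "Y \<subseteq> X - {m}" "card Y = k" "rank_bound c Y \<le> rank_bound c (X - {m})"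
    by blast
  moreover have "rank_bound c (X - {m}) \<le> rank_bound c X"
    using rank_bound_remove_last[OF c Suc(3) m] .
  ultimately show ?case by (intro exI[of _ Y]) auto
qed

text \<open>The hypothesis on \<open>B\<close> is the counting part of the Gale conditions. A gap
  splits \<open>X\<close> into two smaller sets whose bounds add up to at most that of
  \<open>X\<close>; a nonempty set without gaps is a cyclic interval, where the bound is the
  necklace count.\<close>

lemma card_Int_le_rank_bound:
  assumes B: "\<And>a x. a \<in> {1..n} \<Longrightarrow>
      card (B \<inter> cyc_initial n a x) \<le> card (necklace n \<pi> col a \<inter> cyc_initial n a x)"
    and c: "c \<in> {1..n}" and "X \<subseteq> {1..n}"
  shows "int (card (B \<inter> X)) \<le> rank_bound c X"
  using assms(3)
proof (induction "card X" arbitrary: X rule: less_induct)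
  case less
  have fin: "finite X" using less(2) finite_subset[of X "{1..n}"] by simp
  let ?p = "cyc_pos n c"
  consider "X = {}" | (split) h i j where "h \<in> {1..n} - X" "i \<in> X" "j \<in> X" "?p i < ?p h" "?p h < ?p j"
    | (conv) "X \<noteq> {}" "\<And>h i j. h \<in> {1..n} \<Longrightarrow> i \<in> X \<Longrightarrow> j \<in> X \<Longrightarrow> ?p i < ?p h \<Longrightarrow> ?p h < ?p j \<Longrightarrow> h \<in> X"
    by blast
  then show ?case
  proof cases
    case 1
    then show ?thesis by simp
  next
    case (split h i j)
    let ?L = "{j\<in>X. ?p j < ?p h}" and ?U = "{j\<in>X. ?p h < ?p j}"
    have "?p j \<noteq> ?p h" if "j \<in> X" for j using cyc_pos_inj[OF c] that less(2) split(1) by blast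
    then have X: "X = ?L \<union> ?U" by (auto simp: nat_neq_iff)
    have disj: "?L \<inter> ?U = {}" by auto
    have finLU: "finite ?L" "finite ?U" using fin by auto
    \<comment> \<open>An uncut arrow is an interval of positions that avoids \<open>h\<close>, so it
      stays on one side of the gap.\<close>
    have "arrows_in c X \<subseteq> arrows_in c ?L \<union> arrows_in c ?U"
    proof
      fix b assume "b \<in> arrows_in c X"
      then have u: "b \<in> uncut c" "arrow b \<subseteq> X" by (auto simp: arrows_in_def)
      have "h \<notin> arrow b" using u split(1) by blast
      then have "?p h < ?p b \<or> ?p (\<pi> b) < ?p h"
        unfolding arrow_uncut[OF c u(1)] using split(1) by auto
      moreover have "arrow b \<subseteq> ?U" if "?p h < ?p b"
        using u(2) that unfolding arrow_uncut[OF c u(1)] by auto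
      moreover have "arrow b \<subseteq> ?L" if "?p (\<pi> b) < ?p h"
        using u(2) that unfolding arrow_uncut[OF c u(1)] by auto
      ultimately have "arrow b \<subseteq> ?L \<or> arrow b \<subseteq> ?U" by blast
      then show "b \<in> arrows_in c ?L \<union> arrows_in c ?U" using u(1) by (auto simp: arrows_in_def)
    qed
    then have "card (arrows_in c X) \<le> card (arrows_in c ?L \<union> arrows_in c ?U)"
      by (intro card_mono) (simp_all add: finite_arrows_in)
    also have "\<dots> \<le> card (arrows_in c ?L) + card (arrows_in c ?U)" by (rule card_Un_le)
    finally have "card (arrows_in c X) \<le> card (arrows_in c ?L) + card (arrows_in c ?U)" .
    moreover have "card X = card ?L + card ?U"
      using card_Un_disjoint[OF finLU disj] X by simp
    ultimately have "rank_bound c ?L + rank_bound c ?U \<le> rank_bound c X"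
      by (simp add: rank_bound_def)
    moreover have "j \<in> X - ?L" "i \<in> X - ?U" using split(2-5) by auto
    then have "?L \<subset> X" "?U \<subset> X" by blast+
    then have "int (card (B \<inter> ?L)) \<le> rank_bound c ?L" "int (card (B \<inter> ?U)) \<le> rank_bound c ?U"
      using less(1)[OF psubset_card_mono[OF fin]] less(2) by auto
    moreover have "B \<inter> X = (B \<inter> ?L) \<union> (B \<inter> ?U)" using X by blast
    then have "card (B \<inter> X) \<le> card (B \<inter> ?L) + card (B \<inter> ?U)" using card_Un_le by metis
    ultimately show ?thesis by linarith
  next
    case conv
    obtain m where m: "m \<in> X" "\<And>j. j \<in> X \<Longrightarrow> ?p j \<le> ?p m" using ex_last[OF fin conv(1)] by metis
    obtain a where a: "a \<in> X" "\<And>j. j \<in> X \<Longrightarrow> ?p a \<le> ?p j" using ex_first[OF fin conv(1)] by metis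
    have an: "a \<in> {1..n}" and mn: "m \<in> {1..n}" using a m less(2) by auto
    have X: "j \<in> X \<longleftrightarrow> ?p a \<le> ?p j \<and> ?p j \<le> ?p m" if j: "j \<in> {1..n}" for j
      using conv(2)[OF j a(1) m(1)] a m cyc_pos_inj[OF c j an] cyc_pos_inj[OF c j mn]
      by (metis le_less)
    have "j \<in> X \<longleftrightarrow> cyc_pos n a j < Suc (?p m - ?p a)" if j: "j \<in> {1..n}" for j
      unfolding X[OF j] cyc_pos_shift[OF an c j]
      using cyc_pos_less[OF c, of m] cyc_pos_less[OF c, of a] a(2)[OF m(1)] by auto
    \<comment> \<open>The successor is there because both ends \<open>a\<close> and \<open>m\<close>
      belong to the interval.\<close>
    then have XW: "X = cyc_initial n a (Suc (?p m - ?p a))"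
      using less(2) by (auto simp: cyc_initial_def)
    \<comment> \<open>The cut moves to the first element of \<open>X\<close>: as the arrow lies in
      \<open>X\<close>, the positions of its two ends both drop by \<open>?p a\<close> and keep
      their order.\<close>
    have "b \<in> uncut a" if b: "b \<in> uncut c" "arrow b \<subseteq> X" for b
    proof -
      have bn: "b \<in> {1..n}" using b(1) by (simp add: uncut_def)
      have "?p a \<le> ?p b" "?p a \<le> ?p (\<pi> b)"
        using a(2) b(2) arrow_source[OF bn] arrow_target[OF bn] by auto
      then show ?thesis
        using b(1) cyc_pos_shift[OF an c bn] cyc_pos_shift[OF an c perm_in[OF bn]]
        by (simp add: uncut_def cyc_le_def diff_le_mono)
    qed
    then have "rank_bound a X \<le> rank_bound c X" by (rule rank_bound_mono_start)
    moreover have "int (card (B \<inter> X)) \<le> rank_bound a X"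
      using B[OF an] rank_bound_cyc_initial[OF an] XW by simp
    ultimately show ?thesis by simp
  qed
qed

section \<open>Construction of a basis inside \<open>H\<close>\<close>

text \<open>The greedy basis of \<open>H\<close> in the order \<open>1, \<dots>, n\<close>: an element is taken whenever it increases
  the least rank bound \<open>D\<close> of a superset of the elements of \<open>H\<close> seen so far. Submodularity of the
  rank bound compares it with the necklace on every cyclic interval.\<close>

lemma ex_gale_dominating_subset:
  assumes "1 \<le> n" and H: "H \<subseteq> {1..n}"
    and card_neck: "\<And>c. c \<in> {1..n} \<Longrightarrow> card (necklace n \<pi> col c) = d"
    and bound: "\<And>c X. c \<in> {1..n} \<Longrightarrow> H \<subseteq> X \<Longrightarrow> X \<subseteq> {1..n} \<Longrightarrow> int d \<le> rank_bound c X"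
  shows "\<exists>B\<subseteq>H. \<forall>c\<in>{1..n}. gale_le n c (necklace n \<pi> col c) B"
proof -
  have one: "1 \<in> {1..n}" using \<open>1 \<le> n\<close> by simp
  \<comment> \<open>\<open>D j\<close> plays the part of the rank of
    \<open>H \<inter> {1..j}\<close>. With the cut before \<open>1\<close> the cyclic order is the
    usual one, and restricting \<open>X\<close> to \<open>{1..j}\<close> makes \<open>j\<close> the
    last element it can contain.\<close>
  define F where "F j = {X. H \<inter> {1..j} \<subseteq> X \<and> X \<subseteq> {1..j}}" for j
  define D where "D j = Min (rank_bound 1 ` F j)" for j
  define B where "B = {j\<in>{1..n}. D (j - 1) < D j}"
  have finF: "finite (F j)" for j
    by (rule finite_subset[of _ "Pow {1..j}"]) (auto simp: F_def)
  have neF: "F j \<noteq> {}" for j by (auto simp: F_def)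
  have D_le: "D j \<le> rank_bound 1 X" if "X \<in> F j" for X j
    using that finF by (simp add: D_def)
  have D_ex: "\<exists>X\<in>F j. D j = rank_bound 1 X" for j
  proof -
    have "D j \<in> rank_bound 1 ` F j" using finF neF unfolding D_def by (intro Min_in) simp_all
    then show ?thesis by blast
  qed
  have full_bound: "rank_bound c {1..n} = int d" if c: "c \<in> {1..n}" for c
  proof -
    have "necklace n \<pi> col c \<inter> {1..n} = necklace n \<pi> col c" by (auto simp: necklace_def)
    then show ?thesis
      using rank_bound_cyc_initial[OF c, of n] cyc_initial_full[OF c, of n] card_neck[OF c] by simp
  qed
  have "F 0 = {{}}" by (auto simp: F_def)
  then have D0: "D 0 = 0" by (simp add: D_def)
  \<comment> \<open>\<open>F n\<close> contains the whole ground set, whose bound is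
    \<open>d\<close>, and all its members contain \<open>H\<close>, so \<open>bound\<close> applies
    to them.\<close>
  have Dn: "D n = int d"
  proof (rule antisym)
    show "D n \<le> int d" using D_le[of "{1..n}" n] full_bound[OF one] H by (simp add: F_def)
    obtain X where X: "X \<in> F n" "D n = rank_bound 1 X" using D_ex by blast
    then show "int d \<le> D n" using bound[OF one, of X] H by (auto simp: F_def)
  qed
  \<comment> \<open>Together with \<open>skip\<close> and \<open>down\<close> this shows that the
    increments of \<open>D\<close> up to \<open>n\<close> are \<open>0\<close> or \<open>1\<close>,
    and \<open>1\<close> only at elements of \<open>H\<close>.\<close>
  have up: "D (Suc j) \<le> D j + 1" for j
  proof -
    obtain X where X: "X \<in> F j" "D j = rank_bound 1 X" using D_ex by blast
    have "insert (Suc j) X \<in> F (Suc j)" using X(1) by (auto simp: F_def atLeastAtMostSuc_conv)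
    then have "D (Suc j) \<le> rank_bound 1 (insert (Suc j) X)" by (rule D_le)
    also have "\<dots> \<le> rank_bound 1 X + 1"
    proof -
      have "card (insert (Suc j) X) \<le> Suc (card X)" by (cases "finite X") (simp_all add: card_insert_if)
      moreover have "card (arrows_in 1 X) \<le> card (arrows_in 1 (insert (Suc j) X))"
        by (intro card_mono finite_arrows_in) (auto simp: arrows_in_def)
      ultimately show ?thesis by (simp add: rank_bound_def)
    qed
    finally show ?thesis using X(2) by simp
  qed
  have skip: "D (Suc j) \<le> D j" if "Suc j \<notin> H" for j
  proof -
    obtain X where X: "X \<in> F j" "D j = rank_bound 1 X" using D_ex by blast
    have "X \<in> F (Suc j)" using X(1) that by (auto simp: F_def atLeastAtMostSuc_conv)
    then show ?thesis using D_le X(2) by simp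
  qed
  \<comment> \<open>A minimizer for \<open>Suc j\<close> loses at most its last element when
    restricted to \<open>{1..j}\<close>, which does not raise the bound.\<close>
  have down: "D j \<le> D (Suc j)" if j: "Suc j \<le> n" for j
  proof -
    obtain X where X: "X \<in> F (Suc j)" "D (Suc j) = rank_bound 1 X" using D_ex by blast
    have "X - {Suc j} \<in> F j" using X(1) by (auto simp: F_def atLeastAtMostSuc_conv)
    then have "D j \<le> rank_bound 1 (X - {Suc j})" by (rule D_le)
    also have "\<dots> \<le> rank_bound 1 X"
    proof (cases "Suc j \<in> X")
      case True
      have sub: "X \<subseteq> {1..Suc j}" using X(1) by (simp add: F_def)
      show ?thesis
      proof (rule rank_bound_remove_last[OF one _ True])
        show "X \<subseteq> {1..n}" using sub j by auto
        show "cyc_pos n 1 i \<le> cyc_pos n 1 (Suc j)" if "i \<in> X" for i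
        proof -
          have "i \<in> {1..Suc j}" using sub that by blast
          then show ?thesis using j by (auto simp: cyc_pos_eq)
        qed
      qed
    qed simp
    finally show ?thesis using X(2) by simp
  qed
  have "B \<subseteq> H"
  proof
    fix j assume "j \<in> B"
    then have "D (j - 1) < D j" "Suc (j - 1) = j" by (auto simp: B_def)
    then show "j \<in> H" using skip[of "j - 1"] by fastforce
  qed
  \<comment> \<open>\<open>B\<close> collects the unit increments of \<open>D\<close>, so their
    number telescopes.\<close>
  have count: "int (card (B \<inter> {Suc i..j})) = D j - D i" if "i \<le> j" "j \<le> n" for i j
    using that
  proof (induction j rule: dec_induct)
    case base
    then show ?case by simp
  next
    case (step j)
    have IH: "int (card (B \<inter> {Suc i..j})) = D j - D i" using step by simp
    have S: "{Suc i..Suc j} = insert (Suc j) {Suc i..j}" using step(1) by auto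
    show ?case
    proof (cases "Suc j \<in> B")
      case True
      then have "D (Suc j) = D j + 1" using up[of j] by (simp add: B_def)
      moreover have "card (B \<inter> {Suc i..Suc j}) = Suc (card (B \<inter> {Suc i..j}))"
        unfolding S using True by simp
      ultimately show ?thesis using IH by simp
    next
      case False
      then have "D (Suc j) = D j" using down[of j] step(4) by (simp add: B_def)
      moreover have "B \<inter> {Suc i..Suc j} = B \<inter> {Suc i..j}" unfolding S using False by simp
      ultimately show ?thesis using IH by simp
    qed
  qed
  have cardB: "card B = d"
  proof -
    have "B \<inter> {Suc 0..n} = B" by (auto simp: B_def)
    then show ?thesis using count[of 0 n] D0 Dn by simp
  qed
  have "int (card (B \<inter> cyc_initial n c x)) \<le> rank_bound c (cyc_initial n c x)"
    if c: "c \<in> {1..n}" for c x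
  proof -
    let ?Y = "cyc_initial n c x"
    have finY: "finite ?Y" using finite_subset[OF cyc_initial_subset] by simp
    \<comment> \<open>\<open>X\<close> attains the minimum for the elements before \<open>c\<close>;
      where the interval \<open>?Y\<close> is not the whole ground set, submodularity is applied to
      \<open>X\<close> and \<open>?Y\<close>.\<close>
    obtain X where X: "X \<in> F (c - 1)" "D (c - 1) = rank_bound 1 X" using D_ex by blast
    have finX: "finite X" using X(1) finite_subset[of X] by (auto simp: F_def)
    have "{1..c - 1} = {1..<c}" using c by auto
    then have Xc: "X \<subseteq> {1..<c}" "H \<inter> {1..<c} \<subseteq> X" using X(1) by (simp_all add: F_def)
    have X_less: "1 \<le> i" "i < c" if "i \<in> X" for i using subsetD[OF Xc(1) that] by simp_all
    consider (full) "n \<le> x" | (linear) "c + x \<le> n + 1" "x < n" | (wrap) "n + 1 < c + x" "x < n"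
      by linarith
    then show ?thesis
    proof cases
      case full
      then have "?Y = {1..n}" using cyc_initial_full[OF c] by simp
      moreover have "B \<inter> {1..n} = B" by (auto simp: B_def)
      ultimately show ?thesis using full_bound[OF c] cardB by simp
    next
      \<comment> \<open>The interval does not pass from \<open>n\<close> to \<open>1\<close>. Then
        \<open>X \<union> ?Y\<close> competes for the minimum at its right end, so \<open>D\<close>
        grows along \<open>?Y\<close> by at most the bound of \<open>?Y\<close>.\<close>
      case linear
      have Y: "?Y = {Suc (c - 1)..c + x - 1}"
        using c linear by (auto simp: cyc_initial_def cyc_pos_eq[OF c] split: if_splits)
      have "X \<union> ?Y \<in> F (c + x - 1)"
        unfolding F_def Y using Xc(2) c by (force dest: X_less)
      then have "D (c + x - 1) \<le> rank_bound 1 (X \<union> ?Y)" by (rule D_le)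
      moreover have "X \<inter> ?Y = {}" unfolding Y using Xc(1) by auto
      then have "rank_bound 1 (X \<union> ?Y) \<le> rank_bound 1 X + rank_bound 1 ?Y"
        using rank_bound_submodular[OF finX finY, of 1] by simp
      moreover have "rank_bound 1 ?Y \<le> rank_bound c ?Y"
      proof (rule rank_bound_mono_start)
        fix b assume b: "b \<in> uncut c" "arrow b \<subseteq> ?Y"
        show "b \<in> uncut 1"
        proof (cases "c = 1")
          case False
          then have "1 \<notin> arrow b" using b(2) Y c by auto
          then show ?thesis using uncut_if_start_notin[OF one] b(1) by (simp add: uncut_def)
        qed (use b in simp)
      qed
      moreover have "int (card (B \<inter> ?Y)) = D (c + x - 1) - D (c - 1)"
        unfolding Y using linear c by (intro count) auto
      ultimately show ?thesis using X(2) by linarith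
    next
      case wrap
      \<comment> \<open>\<open>l\<close> is the number of elements of the interval that come after
        the passage from \<open>n\<close> to \<open>1\<close>.\<close>
      define l where "l = c + x - 1 - n"
      have lx: "c + x = l + n + 1" using wrap by (simp add: l_def)
      have l: "l < c" "l < n" using c wrap by (auto simp: l_def)
      have Y: "?Y = {Suc (c - 1)..n} \<union> {Suc 0..l}"
        
      proof (rule set_eqI)
        fix j
        have "(1 \<le> j \<and> j \<le> n \<and> (if c \<le> j then j - c else j + n - c) < x) \<longleftrightarrow>
            (c \<le> j \<and> j \<le> n) \<or> (1 \<le> j \<and> j \<le> l)"
          using c wrap lx by (cases "c \<le> j") auto
        then show "j \<in> ?Y \<longleftrightarrow> j \<in> {Suc (c - 1)..n} \<union> {Suc 0..l}"
          using c cyc_pos_eq[OF c, of j] by (auto simp: cyc_initial_def)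
      qed
      \<comment> \<open>The union contains \<open>H\<close>, so its bound is at least
        \<open>D n\<close>; the intersection competes for \<open>D l\<close>. Submodularity at the
        cut \<open>c\<close> yields \<open>D n + D l \<le> D (c - 1) + rank_bound c ?Y\<close>,
        which is the claim because \<open>D 0 = 0\<close>.\<close>
      have "int d \<le> rank_bound c (X \<union> ?Y)"
      proof (rule bound[OF c])
        show "H \<subseteq> X \<union> ?Y" unfolding Y using H Xc(2) c by fastforce
        show "X \<union> ?Y \<subseteq> {1..n}" using c cyc_initial_subset by (fastforce dest: X_less)
      qed
      moreover have "D l \<le> rank_bound 1 (X \<inter> ?Y)"
      proof (rule D_le)
        show "X \<inter> ?Y \<in> F l" unfolding F_def Y using Xc(2) l by (auto dest: X_less)
      qed
      \<comment> \<open>\<open>X\<close> lies before \<open>c\<close>. So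
        \<open>X \<inter> ?Y\<close> omits \<open>n\<close> and its arrows avoid the cut before
        \<open>1\<close>; likewise \<open>X\<close> omits \<open>c\<close> and its arrows avoid the
        cut before \<open>c\<close>.\<close>
      moreover have "rank_bound 1 (X \<inter> ?Y) \<le> rank_bound c (X \<inter> ?Y)"
      proof (rule rank_bound_mono_start)
        fix b assume b: "b \<in> uncut c" "arrow b \<subseteq> X \<inter> ?Y"
        then have "n \<notin> arrow b" using c X_less(2)[of n] by auto
        then show "b \<in> uncut 1" using uncut_if_end_notin b(1) by (simp add: uncut_def)
      qed
      moreover have "rank_bound c X \<le> rank_bound 1 X"
      proof (rule rank_bound_mono_start)
        fix b assume b: "b \<in> uncut 1" "arrow b \<subseteq> X"
        then have "c \<notin> arrow b" using X_less(2)[of c] by auto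
        then show "b \<in> uncut c" using uncut_if_start_notin[OF c] b(1) by (simp add: uncut_def)
      qed
      moreover have "rank_bound c (X \<union> ?Y) + rank_bound c (X \<inter> ?Y) \<le> rank_bound c X + rank_bound c ?Y"
        by (rule rank_bound_submodular[OF finX finY])
      moreover have "card (B \<inter> ?Y) \<le> card (B \<inter> {Suc (c - 1)..n}) + card (B \<inter> {Suc 0..l})"
        unfolding Y Int_Un_distrib by (rule card_Un_le)
      moreover have "int (card (B \<inter> {Suc (c - 1)..n})) = D n - D (c - 1)"
        using c by (intro count) auto
      moreover have "int (card (B \<inter> {Suc 0..l})) = D l - D 0"
        using l by (intro count) auto
      ultimately show ?thesis using X(2) Dn D0 by linarith
    qed
  qed
  then have "card (B \<inter> cyc_initial n c x) \<le> card (necklace n \<pi> col c \<inter> cyc_initial n c x)"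
    if "c \<in> {1..n}" for c x
    using that rank_bound_cyc_initial[OF that, of x] by (metis of_nat_le_iff)
  moreover have "necklace n \<pi> col c \<subseteq> {1..n}" for c by (auto simp: necklace_def)
  moreover have "B \<subseteq> {1..n}" by (auto simp: B_def)
  ultimately have "\<forall>c\<in>{1..n}. gale_le n c (necklace n \<pi> col c) B"
    using gale_le_iff card_neck cardB by simp
  then show ?thesis using \<open>B \<subseteq> H\<close> by blast
qed

end


section \<open>Flag positroids with a uniform second member\<close>

text \<open>Rotation by \<open>k\<close> has as necklace the first \<open>k\<close> elements of each
  cyclic order, and these lie Gale-below every \<open>k\<close>-set.\<close>

lemma positroid_uniform:
  assumes "k < n"
  shows "positroid n (uniform_matroid k n)"
proof -
  have one: "1 \<in> {1..n}" using assms by simp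
  \<comment> \<open>Residues are represented in \<open>{1..n}\<close>, with the identity elsewhere
    as \<open>permutes\<close> demands; \<open>\<rho>\<close> is the inverse on
    \<open>{1..n}\<close>.\<close>
  define \<pi> where "\<pi> j = (if j \<in> {1..n} then if j + k \<le> n then j + k else j + k - n else j)" for j
  define \<rho> where "\<rho> j = (if k < j then j - k else j + n - k)" for j
  \<comment> \<open>As \<open>k < n\<close>, the rotation has fixed points only for
    \<open>k = 0\<close>; all of them must then be loops to give rank \<open>0\<close>.\<close>
  define col :: "nat \<Rightarrow> int" where "col j = (if k = 0 then 1 else 0)" for j
  have "bij_betw \<pi> {1..n} {1..n}"
    using assms by (intro bij_betwI[where g = \<rho>]) (auto simp: \<pi>_def \<rho>_def)
  then have perm: "\<pi> permutes {1..n}"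
    by (rule bij_imp_permutes) (auto simp: \<pi>_def)
  have dec: "decorated_permutation n \<pi> col"
    using perm assms by (auto simp: decorated_permutation_def col_def \<pi>_def)
  have inv: "inv \<pi> j = \<rho> j" if "j \<in> {1..n}" for j
    using that assms by (subst permutes_inv_eq[OF perm]) (auto simp: \<pi>_def \<rho>_def)
  have neck: "necklace n \<pi> col i = cyc_initial n i k" if i: "i \<in> {1..n}" for i
  proof -
    have "cyc_less n i j (\<rho> j) \<longleftrightarrow> cyc_pos n i j < k" if j: "j \<in> {1..n}" for j
    proof -
      have "\<rho> j \<in> {1..n}" using j assms by (auto simp: \<rho>_def)
      then show ?thesis
        using i j assms by (auto simp: cyc_less_def cyc_pos_eq \<rho>_def split: if_splits)
    qed
    then show ?thesis using inv by (auto simp: necklace_def cyc_initial_def col_def)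
  qed
  have "gale_le n i (necklace n \<pi> col i) B \<longleftrightarrow> card B = k"
    if i: "i \<in> {1..n}" and B: "B \<subseteq> {1..n}" for i B
  proof -
    have fin: "finite B" using B finite_subset[of B "{1..n}"] by simp
    have "card (B \<inter> cyc_initial n i x) \<le> card (cyc_initial n i k \<inter> cyc_initial n i x)"
      if "card B = k" for x
    proof -
      have W: "finite (cyc_initial n i x)" using finite_subset[OF cyc_initial_subset] by simp
      have "card (B \<inter> cyc_initial n i x) \<le> k" using card_mono[OF fin, of "B \<inter> cyc_initial n i x"] that by simp
      moreover have "card (B \<inter> cyc_initial n i x) \<le> card (cyc_initial n i x)"
        using W by (intro card_mono) auto
      moreover have "cyc_initial n i k \<inter> cyc_initial n i x = cyc_initial n i (min k x)"
        by (auto simp: cyc_initial_def)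
      moreover have "card (cyc_initial n i (min k x)) = min k x"
        using card_cyc_initial[OF i] assms by simp
      ultimately show ?thesis using card_cyc_initial[OF i, of x] assms by (cases "k \<le> x") auto
    qed
    then show ?thesis
      using gale_le_iff[OF i cyc_initial_subset B] neck[OF i] card_cyc_initial[OF i, of k] assms by auto
  qed
  then have "bases (uniform_matroid k n) =
      {B. B \<subseteq> {1..n} \<and> (\<forall>i\<in>{1..n}. gale_le n i (necklace n \<pi> col i) B)}"
    using one by (auto simp only: uniform_matroid_def select_convs)
  then have "positroid_of n \<pi> col (uniform_matroid k n)"
    using dec matroid_uniform[of k n] assms by (simp add: positroid_of_def)
  then show ?thesis unfolding positroid_def by blast
qed

text \<open>The two equivalences differ only in the demand that both matroids be positroids, which
  \<open>positroid_uniform\<close> and the hypothesis on \<open>M\<close> supply.\<close>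

theorem theorem1p2:
  fixes r k n :: nat
    and \<pi> :: "nat \<Rightarrow> nat" and col :: "nat \<Rightarrow> int"
    and M :: "nat set_system"
  assumes "r \<le> k" and "k < n"
    and "positroid_of n \<pi> col M"
    and "matroid_rank M = k - r"
  shows "(matroid_quotient M (uniform_matroid k n) \<longleftrightarrow>
           (\<forall>S. S \<subseteq> {1..n} \<and> card S = r + 1 \<longrightarrow> card (\<Union>i\<in>S. CW_arrow n \<pi> col i) \<ge> k + 1))
       \<and> (flag_positroid n M (uniform_matroid k n) \<longleftrightarrow>
           (\<forall>S. S \<subseteq> {1..n} \<and> card S = r + 1 \<longrightarrow> card (\<Union>i\<in>S. CW_arrow n \<pi> col i) \<ge> k + 1))"
proof -
  have M: "matroid M" "ground M = {1..n}"
    and bases: "bases M = {B. B \<subseteq> {1..n} \<and> (\<forall>i\<in>{1..n}. gale_le n i (necklace n \<pi> col i) B)}"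
    using assms(3) by (simp_all add: positroid_of_def)
  interpret decorated_perm n \<pi> col
    using assms(3) by unfold_locales (simp add: positroid_of_def)
  have card_basis_M: "card B = k - r" if "B \<in> bases M" for B
    using card_basis[OF M(1) that] assms(4) by simp
  have neck_sub: "necklace n \<pi> col c \<subseteq> {1..n}" for c by (auto simp: necklace_def)
  \<comment> \<open>Some basis exists, and \<open>gale_le\<close> forces the necklace members to
    have its size.\<close>
  have card_neck: "card (necklace n \<pi> col c) = k - r" if c: "c \<in> {1..n}" for c
  proof -
    obtain B where B: "B \<in> bases M" using M(1) unfolding matroid_def by blast
    then have "gale_le n c (necklace n \<pi> col c) B" using bases c by blast
    then show ?thesis using card_basis_M[OF B] by (simp add: gale_le_def)
  qed
  have "(\<forall>X. X \<subseteq> {1..n} \<and> card X = k \<longrightarrow> (\<exists>B\<in>bases M. B \<subseteq> X)) \<longleftrightarrow>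
    (\<forall>S. S \<subseteq> {1..n} \<and> card S = r + 1 \<longrightarrow> card (\<Union>i\<in>S. arrow i) \<ge> k + 1)" (is "?L \<longleftrightarrow> ?R")
  proof
    assume L: ?L
    show ?R
    proof (intro allI impI, rule ccontr)
      fix S assume S: "S \<subseteq> {1..n} \<and> card S = r + 1"
      define U where "U = (\<Union>i\<in>S. arrow i)"
      assume "\<not> k + 1 \<le> card (\<Union>i\<in>S. arrow i)"
      then have U: "card U \<le> k" by (simp add: U_def)
      have Un: "U \<subseteq> {1..n}" using arrow_subset by (auto simp: U_def)
      then obtain X where X: "U \<subseteq> X" "X \<subseteq> {1..n}" "card X = k"
        using exists_subset_between[of U k "{1..n}"] U \<open>k < n\<close> by auto
      obtain B where B: "B \<in> bases M" "B \<subseteq> X" using L X by metis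
      have "U \<noteq> {1..n}" using U \<open>k < n\<close> by auto
      \<comment> \<open>Cutting at an element outside \<open>U\<close> leaves every arrow from
        \<open>S\<close> uncut, so all \<open>r + 1\<close> of them are counted in
        \<open>U\<close>.\<close>
      then obtain c where c: "c \<in> {1..n}" "c \<notin> U" using Un by blast
      have "S \<subseteq> arrows_in c U"
      proof
        fix b assume b: "b \<in> S"
        then have "arrow b \<subseteq> U" by (auto simp: U_def)
        moreover from this have "b \<in> uncut c" using uncut_if_start_notin c S b by blast
        ultimately show "b \<in> arrows_in c U" by (simp add: arrows_in_def)
      qed
      then have "r + 1 \<le> card (arrows_in c U)" using card_mono[OF finite_arrows_in] S by metis
      moreover have "int (card (B \<inter> U)) \<le> rank_bound c U"
      proof (rule card_Int_le_rank_bound[OF _ c(1) Un])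
        fix a x assume a: "a \<in> {1..n}"
        have "B \<subseteq> {1..n}" "gale_le n a (necklace n \<pi> col a) B" using B(1) bases a by auto
        then show "card (B \<inter> cyc_initial n a x) \<le> card (necklace n \<pi> col a \<inter> cyc_initial n a x)"
          using gale_le_iff[OF a neck_sub] by blast
      qed
      \<comment> \<open>\<open>B\<close> has at most \<open>k - card U\<close> elements outside
        \<open>U\<close>, and the rank bound allows at most \<open>card U - (r + 1)\<close> inside,
        too few for a basis.\<close>
      moreover have "k - r \<le> card (B \<inter> U) + (k - card U)"
      proof -
        have finX: "finite X" using X(2) finite_subset[of X "{1..n}"] by simp
        have "B \<subseteq> (B \<inter> U) \<union> (X - U)" using B(2) by blast
        then have "card B \<le> card ((B \<inter> U) \<union> (X - U))"
          using finX B(2) finite_subset[OF B(2) finX] by (intro card_mono) auto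
        also have "\<dots> \<le> card (B \<inter> U) + card (X - U)" by (rule card_Un_le)
        also have "card (X - U) = k - card U"
          using X card_Diff_subset[OF finite_subset[OF X(1) finX] X(1)] by simp
        finally show ?thesis using card_basis_M[OF B(1)] by simp
      qed
      ultimately show False using U \<open>r \<le> k\<close> by (simp add: rank_bound_def)
    qed
  next
    assume R: ?R
    show ?L
    proof (intro allI impI)
      fix H assume H: "H \<subseteq> {1..n} \<and> card H = k"
      \<comment> \<open>A set with a smaller bound could be shrunk to size \<open>k\<close> and
        would then contain more than \<open>r\<close> arrows; the union of \<open>r + 1\<close> of
        them would have at most \<open>k\<close> elements, against the arrow condition.\<close>
      have bound: "int (k - r) \<le> rank_bound c X"
        if c: "c \<in> {1..n}" and X: "H \<subseteq> X" "X \<subseteq> {1..n}" for c X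
      proof (rule ccontr)
        assume lt: "\<not> ?thesis"
        have "k \<le> card X" using H X card_mono[of X H] finite_subset[of X "{1..n}"] by auto
        then obtain Y where Y: "Y \<subseteq> X" "card Y = k" "rank_bound c Y \<le> rank_bound c X"
          using rank_bound_shrink[OF c X(2)] by blast
        have "r + 1 \<le> card (arrows_in c Y)"
          using lt Y(2,3) \<open>r \<le> k\<close> by (simp add: rank_bound_def)
        then obtain S where S: "S \<subseteq> arrows_in c Y" "card S = r + 1"
          by (meson obtain_subset_with_card_n)
        have "S \<subseteq> {1..n}" using S(1) by (auto simp: arrows_in_def uncut_def)
        then have "k + 1 \<le> card (\<Union>i\<in>S. arrow i)" using R S(2) by blast
        also have "\<dots> \<le> card Y"
          using S(1) finite_subset[of Y "{1..n}"] Y(1) X(2)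
          by (intro card_mono) (auto simp: arrows_in_def)
        finally show False using Y(2) by simp
      qed
      have "1 \<le> n" "H \<subseteq> {1..n}" using \<open>k < n\<close> H by auto
      from ex_gale_dominating_subset[OF this card_neck bound]
      obtain B where B: "B \<subseteq> H" "\<forall>c\<in>{1..n}. gale_le n c (necklace n \<pi> col c) B" by blast
      then have "B \<in> bases M" using bases H by blast
      then show "\<exists>B\<in>bases M. B \<subseteq> H" using B(1) by blast
    qed
  qed
  then have "matroid_quotient M (uniform_matroid k n) \<longleftrightarrow> ?R"
    using quotient_of_uniform_iff[OF M \<open>k < n\<close>] by simp
  moreover have "flag_positroid n M (uniform_matroid k n) \<longleftrightarrow> matroid_quotient M (uniform_matroid k n)"
    using positroid_uniform[OF \<open>k < n\<close>] assms(3) unfolding flag_positroid_def positroid_def by blast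
  ultimately show ?thesis by blast
qed

end
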